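(* Let $M=(E,\mathcal{I})$ be a matroid of rank $n$. For $0\le k\le n$, let $I_k$ be the number of independent sets of $M$ of rank $k$ (that is, with $k$ elements). Then $I_k^2\ge I_{k-1}I_{k+1}$ for all $2\le k\le n-1$.
   Context: $M=(E,\mathcal I)$ denotes a matroid on a finite ground set $E$ with collection of independent sets $\mathcal I$. *)

theory Defs
  imports Main
begin

locale matroid =
  fixes E :: "'a set" and \<I> :: "'a set set"
  assumes finite_ground: "finite E"
    and indep_subset_ground: "X \<in> \<I> \<Longrightarrow> X \<subseteq> E"
    and indep_empty: "{} \<in> \<I>"
    and indep_hereditary: "X \<in> \<I> \<Longrightarrow> Y \<subseteq> X \<Longrightarrow> Y \<in> \<I>"
    and indep_augment:
      "X \<in> \<I> \<Longrightarrow> Y \<in> \<I> \<Longrightarrow> card X < card Y \<Longrightarrow> \<exists>y \<in> Y - X. insert y X \<in> \<I>"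

text \<open>The rank of a set \<open>A\<close> is the largest size of an independent subset of \<open>A\<close>;
  the rank of the matroid is the rank of its ground set.\<close>

definition rank_of :: "'a set set \<Rightarrow> 'a set \<Rightarrow> nat" where
  "rank_of \<I> A = Max (card ` {X \<in> \<I>. X \<subseteq> A})"

definition matroid_rank :: "'a set \<Rightarrow> 'a set set \<Rightarrow> nat" where
  "matroid_rank E \<I> = rank_of \<I> E"

definition num_indep :: "'a set set \<Rightarrow> nat \<Rightarrow> nat" where
  "num_indep \<I> k = card {X \<in> \<I>. card X = k}"

text \<open>Counting independent sets by size is the same as counting them by rank.\<close>

lemma (in matroid) rank_of_indep:
  assumes "X \<in> \<I>"
  shows "rank_of \<I> X = card X"
proof -
  have "finite X"
    using assms finite_ground indep_subset_ground finite_subset by blast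
  then show ?thesis
    unfolding rank_of_def using assms
    by (intro Max_eqI) (auto intro: card_mono)
qed

lemma (in matroid) num_indep_eq_rank:
  "num_indep \<I> k = card {X \<in> \<I>. rank_of \<I> X = k}"
  unfolding num_indep_def by (rule arg_cong[where f = card]) (auto simp: rank_of_indep)

end

theory Submission
  imports Defs Complex_Main "HOL-Library.Multiset"
begin

text \<open>Fix \<open>0 < t \<le> 1\<close> and weight a word over \<open>E \<union> {None}\<close> by \<open>t\<close> to the number of
  letters \<^term>\<open>None\<close> if its other letters are distinct and form an independent set, and by
  \<open>0\<close> otherwise. Let \<open>N(U, m)\<close> be the total weight of the words of length \<open>m\<close> appended to \<open>U\<close>.
  By induction on \<open>m\<close>, the matrices \<open>H(a, b) = N(U + a + b, m)\<close> have at most one positive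
  eigenvalue. For \<open>m = 0\<close> the matrix is a rank-one form minus the positive semidefinite form of
  the parallelism relation. For the step, \<open>H\<close> is the sum of the matrices \<open>H\<^sub>a\<close> belonging to
  \<open>U + a\<close> and \<open>m - 1\<close>, and row \<open>a\<close> of \<open>H\<close> is \<open>H\<^sub>a 1\<close>; the reverse Cauchy--Schwarz
  inequalities for the \<open>H\<^sub>a\<close> sum up to \<open>B \<le> B\<^sup>2\<close> for the Markov operator \<open>B\<close> obtained by
  normalizing the rows of \<open>H\<close>. So \<open>B\<close> has no eigenvalue strictly between \<open>0\<close> and \<open>1\<close>, while the
  entries of column \<^term>\<open>None\<close>, proportional to \<open>t\<close>, bound \<open>B\<close> away from \<open>1\<close> on the mean-zero
  functions. Testing \<open>H\<close> on the vector supported at \<^term>\<open>None\<close> gives log-concavity of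
  \<open>N({}, m)\<close>, which tends to \<open>m!\<close> times the number of independent \<open>m\<close>-sets as \<open>t\<close> tends to \<open>0\<close>.\<close>

section \<open>Reversible kernels\<close>

locale reversible_kernel =
  fixes V :: "'b set" and G :: "'b \<Rightarrow> 'b \<Rightarrow> real"
  assumes finite_V: "finite V"
    and G_sym: "a \<in> V \<Longrightarrow> b \<in> V \<Longrightarrow> G a b = G b a"
    and G_nonneg: "a \<in> V \<Longrightarrow> b \<in> V \<Longrightarrow> 0 \<le> G a b"
begin

definition g :: "'b \<Rightarrow> real" where "g a = (\<Sum>b\<in>V. G a b)"

definition B :: "('b \<Rightarrow> real) \<Rightarrow> 'b \<Rightarrow> real" where "B y a = (\<Sum>b\<in>V. G a b * y b) / g a"

definition inner_g :: "('b \<Rightarrow> real) \<Rightarrow> ('b \<Rightarrow> real) \<Rightarrow> real" where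
  "inner_g y w = (\<Sum>a\<in>V. g a * y a * w a)"

definition mean_zero :: "('b \<Rightarrow> real) \<Rightarrow> bool" where "mean_zero y \<longleftrightarrow> (\<Sum>a\<in>V. g a * y a) = 0"

lemma g_nonneg: "a \<in> V \<Longrightarrow> 0 \<le> g a"
  unfolding g_def by (simp add: sum_nonneg G_nonneg)

text \<open>Where \<open>g a = 0\<close>, division makes \<open>B y a = 0\<close>; the identity
  survives because nonnegative entries with sum 0 all vanish.\<close>

lemma g_times_B:
  assumes "a \<in> V"
  shows "g a * B y a = (\<Sum>b\<in>V. G a b * y b)"
proof (cases "g a = 0")
  case True
  then have "\<forall>b\<in>V. G a b = 0"
    using sum_nonneg_eq_0_iff[OF finite_V, of "G a"] G_nonneg assms unfolding g_def by auto
  then show ?thesis using True by simp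
qed (simp add: B_def)

lemma inner_B: "inner_g w (B y) = (\<Sum>a\<in>V. \<Sum>b\<in>V. G a b * w a * y b)"
proof -
  have "inner_g w (B y) = (\<Sum>a\<in>V. w a * (g a * B y a))"
    unfolding inner_g_def by (simp add: mult_ac)
  also have "\<dots> = (\<Sum>a\<in>V. w a * (\<Sum>b\<in>V. G a b * y b))"
    by (intro sum.cong) (auto simp: g_times_B)
  finally show ?thesis by (simp add: sum_distrib_left mult_ac)
qed

lemma inner_commute: "inner_g y w = inner_g w y"
  unfolding inner_g_def by (simp add: mult_ac)

lemma B_self_adjoint: "inner_g w (B y) = inner_g (B w) y"
proof -
  have "inner_g w (B y) = (\<Sum>b\<in>V. \<Sum>a\<in>V. G a b * w a * y b)"
    unfolding inner_B by (rule sum.swap)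
  also have "\<dots> = inner_g y (B w)"
    unfolding inner_B by (intro sum.cong refl) (auto simp: G_sym)
  finally show ?thesis by (simp add: inner_commute)
qed

lemma inner_add_right: "inner_g y (\<lambda>a. p * u a + q * w a) = p * inner_g y u + q * inner_g y w"
  unfolding inner_g_def by (simp add: sum_distrib_left sum.distrib algebra_simps)

lemma B_linear: "B (\<lambda>a. p * u a + q * w a) = (\<lambda>a. p * B u a + q * B w a)"
  unfolding B_def
  by (rule ext) (simp add: sum_distrib_left sum.distrib algebra_simps add_divide_distrib sum_divide_distrib)

lemma inner_nonneg: "0 \<le> inner_g y y"
  unfolding inner_g_def by (intro sum_nonneg) (simp add: g_nonneg mult.assoc)

lemma sum_G_weight: "(\<Sum>a\<in>V. \<Sum>b\<in>V. G a b * f a) = (\<Sum>a\<in>V. g a * f a)"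
  unfolding g_def by (simp add: sum_distrib_right)

lemma sum_G_weight': "(\<Sum>a\<in>V. \<Sum>b\<in>V. G a b * f b) = (\<Sum>a\<in>V. g a * f a)"
proof -
  have "(\<Sum>a\<in>V. \<Sum>b\<in>V. G a b * f b) = (\<Sum>b\<in>V. \<Sum>a\<in>V. G a b * f b)"
    by (rule sum.swap)
  also have "\<dots> = (\<Sum>b\<in>V. \<Sum>a\<in>V. G b a * f b)"
    by (intro sum.cong refl) (auto simp: G_sym)
  finally show ?thesis by (simp add: sum_G_weight)
qed

lemma mean_zero_B:
  assumes "mean_zero y"
  shows "mean_zero (B y)"
proof -
  have "(\<Sum>a\<in>V. g a * B y a) = (\<Sum>a\<in>V. \<Sum>b\<in>V. G a b * y b)"
    by (intro sum.cong) (auto simp: g_times_B)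
  then show ?thesis using assms by (simp add: mean_zero_def sum_G_weight')
qed

lemma mean_zero_add: "mean_zero u \<Longrightarrow> mean_zero w \<Longrightarrow> mean_zero (\<lambda>a. p * u a + q * w a)"
  unfolding mean_zero_def
  by (simp add: ring_distribs sum.distrib mult.left_commute[of _ p] mult.left_commute[of _ q]
      flip: sum_distrib_left)

text \<open>Taking \<open>c = 1\<close> gives \<open>-1 \<le> B\<close>; taking
  \<open>c = -1\<close> gives the Dirichlet form of \<open>2 (1 - B)\<close>.\<close>

lemma dirichlet_form:
  "(\<Sum>a\<in>V. \<Sum>b\<in>V. G a b * (y a + c * y b)\<^sup>2) = (1 + c\<^sup>2) * inner_g y y + 2 * c * inner_g y (B y)"
proof -
  have "(\<Sum>a\<in>V. \<Sum>b\<in>V. G a b * (y a + c * y b)\<^sup>2)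
      = (\<Sum>a\<in>V. \<Sum>b\<in>V. G a b * (y a)\<^sup>2) + c\<^sup>2 * (\<Sum>a\<in>V. \<Sum>b\<in>V. G a b * (y b)\<^sup>2)
        + 2 * c * (\<Sum>a\<in>V. \<Sum>b\<in>V. G a b * y a * y b)"
    by (simp add: sum_distrib_left sum.distrib[symmetric] power2_eq_square algebra_simps)
  then show ?thesis
    unfolding sum_G_weight sum_G_weight' inner_B
    by (simp add: inner_g_def power2_eq_square algebra_simps)
qed

section \<open>Bounds on the spectrum of \<open>B\<close>\<close>

lemma B_ge_minus_one: "0 \<le> inner_g y y + inner_g y (B y)"
proof -
  have "0 \<le> (\<Sum>a\<in>V. \<Sum>b\<in>V. G a b * (y a + 1 * y b)\<^sup>2)"
    by (intro sum_nonneg) (simp add: G_nonneg)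
  then show ?thesis unfolding dirichlet_form by simp
qed

text \<open>The terms of the Dirichlet form with \<open>b = z\<close> alone are at least \<epsilon>
  times the second moment of \<open>y\<close> about \<open>y z\<close>, and a second moment is
  smallest about the mean, here 0.\<close>

lemma spectral_gap:
  assumes "z \<in> V" "0 \<le> \<epsilon>" and eps: "\<And>a. a \<in> V \<Longrightarrow> \<epsilon> * g a \<le> G a z" and "mean_zero y"
  shows "inner_g y (B y) \<le> (1 - \<epsilon> / 2) * inner_g y y"
proof -
  have "\<epsilon> * inner_g y y \<le> \<epsilon> * (\<Sum>a\<in>V. g a * (y a - y z)\<^sup>2)"
  proof -
    have "(\<Sum>a\<in>V. g a * (y a - y z)\<^sup>2)
        = inner_g y y - 2 * y z * (\<Sum>a\<in>V. g a * y a) + (\<Sum>a\<in>V. g a * (y z)\<^sup>2)"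
      unfolding inner_g_def
      by (simp add: sum_distrib_left sum_subtractf[symmetric] sum.distrib[symmetric]
          power2_eq_square algebra_simps)
    moreover have "0 \<le> (\<Sum>a\<in>V. g a * (y z)\<^sup>2)" by (intro sum_nonneg) (simp add: g_nonneg)
    ultimately show ?thesis
      using assms(2,4) by (simp add: mean_zero_def mult_left_mono)
  qed
  also have "\<dots> \<le> (\<Sum>a\<in>V. G a z * (y a - y z)\<^sup>2)"
    unfolding sum_distrib_left mult.assoc[symmetric]
    by (intro sum_mono mult_right_mono eps) auto
  also have "\<dots> \<le> (\<Sum>a\<in>V. \<Sum>b\<in>V. G a b * (y a - y b)\<^sup>2)"
    by (intro sum_mono member_le_sum) (auto simp: finite_V \<open>z \<in> V\<close> G_nonneg)
  also have "\<dots> = 2 * inner_g y y - 2 * inner_g y (B y)"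
    using dirichlet_form[of y "-1"] by simp
  finally show ?thesis by (simp add: algebra_simps)
qed

text \<open>If \<open>B \<le> \<lambda>\<close> on the mean-zero functions then, since also \<open>-1 \<le> B\<close>,
  \<open>(1 + \<lambda>) (\<lambda> - B) (1 + B) = (\<lambda> - B) (1 + B) (\<lambda> - B) + (1 + B) (\<lambda> - B) (1 + B) \<ge> 0\<close>.
  Combined with \<open>B \<le> B\<^sup>2\<close> this gives \<open>(2 - \<lambda>) B \<le> \<lambda>\<close>.\<close>

lemma improve_upper_bound:
  assumes upper: "\<And>y. mean_zero y \<Longrightarrow> inner_g y (B y) \<le> l * inner_g y y"
    and square: "\<And>y. inner_g y (B y) \<le> inner_g (B y) (B y)"
    and "0 \<le> l" and y: "mean_zero y"
  shows "(2 - l) * inner_g y (B y) \<le> l * inner_g y y"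
proof -
  define m0 m1 m2 m3 where "m0 = inner_g y y" and "m1 = inner_g y (B y)"
    and "m2 = inner_g (B y) (B y)" and "m3 = inner_g (B y) (B (B y))"
  have m2': "inner_g y (B (B y)) = m2" unfolding m2_def by (rule B_self_adjoint)
  have sq: "inner_g (\<lambda>a. p * y a + q * B y a) (\<lambda>a. p * y a + q * B y a)
      = p\<^sup>2 * m0 + 2 * p * q * m1 + q\<^sup>2 * m2" for p q
    by (simp add: inner_add_right inner_commute[of "\<lambda>a. p * y a + q * B y a"]
        inner_commute[of "B y" y] m0_def m1_def m2_def power2_eq_square algebra_simps)
  have sqB: "inner_g (\<lambda>a. p * y a + q * B y a) (B (\<lambda>a. p * y a + q * B y a))
      = p\<^sup>2 * m1 + 2 * p * q * m2 + q\<^sup>2 * m3" for p q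
    unfolding B_linear inner_add_right inner_commute[of "\<lambda>a. p * y a + q * B y a"]
    by (simp add: inner_commute[of "B y" y] inner_commute[of "B (B y)"] m2'
        flip: m0_def m1_def m2_def m3_def) (simp add: power2_eq_square algebra_simps)
  \<comment> \<open>First \<open>-1 \<le> B\<close> tested at \<open>(l - B) y\<close>, then
    \<open>B \<le> l\<close> tested at \<open>(1 + B) y\<close>.\<close>
  have "0 \<le> (l\<^sup>2 * m0 - 2 * l * m1 + m2) + (l\<^sup>2 * m1 - 2 * l * m2 + m3)"
    using B_ge_minus_one[of "\<lambda>a. l * y a + (-1) * B y a"] unfolding sq sqB by simp
  moreover have "m1 + 2 * m2 + m3 \<le> l * (m0 + 2 * m1 + m2)"
    using upper[OF mean_zero_add[OF y mean_zero_B[OF y], of 1 1]] unfolding sq sqB by simp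
  ultimately have "0 \<le> (1 + l) * (l * m0 + (l - 1) * m1 - m2)"
    by (simp add: power2_eq_square algebra_simps)
  then have "0 \<le> l * m0 + (l - 1) * m1 - m2"
    using \<open>0 \<le> l\<close> by (simp add: zero_le_mult_iff)
  moreover have "m1 \<le> m2" unfolding m1_def m2_def by (rule square)
  ultimately show ?thesis by (simp add: m0_def m1_def algebra_simps)
qed

text \<open>\<open>improve_upper_bound\<close> turns a bound \<open>q\<close> into
  \<open>q / (2 - q)\<close>. Starting from the spectral gap \<open>l < 1\<close>, all bounds stay
  at most \<open>l\<close>, so each round gains at least the factor
  \<open>r = 1 / (2 - l) < 1\<close>, and the bounds tend to 0.\<close>

lemma B_nonpos_on_mean_zero:
  assumes "z \<in> V" "0 < \<epsilon>" "\<epsilon> \<le> 1" and eps: "\<And>a. a \<in> V \<Longrightarrow> \<epsilon> * g a \<le> G a z"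
    and square: "\<And>y. inner_g y (B y) \<le> inner_g (B y) (B y)"
    and "mean_zero y"
  shows "inner_g y (B y) \<le> 0"
proof -
  define l r where "l = 1 - \<epsilon> / 2" and "r = 1 / (2 - l)"
  have l: "0 \<le> l" "l < 1" and r: "0 < r" "r < 1" using assms(2,3) by (auto simp: l_def r_def)
  have bound: "inner_g y (B y) \<le> l * r ^ n * inner_g y y" if "mean_zero y" for n y
    using that
  proof (induction n arbitrary: y)
    case 0
    then show ?case using spectral_gap[OF assms(1) _ eps] assms(2) by (simp add: l_def)
  next
    case (Suc n)
    define q where "q = l * r ^ n"
    have q: "0 \<le> q" "q \<le> l"
      using l r by (auto simp: q_def mult_left_le power_le_one)
    have "(2 - q) * inner_g y (B y) \<le> q * inner_g y y"
      using Suc by (intro improve_upper_bound square) (auto simp: q_def[symmetric] q)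
    then have "inner_g y (B y) \<le> q / (2 - q) * inner_g y y"
      using q l by (simp add: field_simps)
    also have "\<dots> \<le> q / (2 - l) * inner_g y y"
      using q l by (intro mult_right_mono divide_left_mono inner_nonneg) auto
    finally show ?case by (simp add: q_def r_def)
  qed
  have "(\<lambda>n. l * r ^ n * inner_g y y) \<longlonglongrightarrow> l * 0 * inner_g y y"
    using r by (intro tendsto_intros LIMSEQ_realpow_zero) auto
  then show ?thesis
    using bound[OF assms(6)] by (intro LIMSEQ_le_const[of _ 0]) auto
qed

lemma reverse_cauchy_schwarz:
  assumes "z \<in> V" "0 < \<epsilon>" "\<epsilon> \<le> 1" and eps: "\<And>a. a \<in> V \<Longrightarrow> \<epsilon> * g a \<le> G a z"
    and square: "\<And>y. inner_g y (B y) \<le> inner_g (B y) (B y)"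
  shows "inner_g y (B y) * (\<Sum>a\<in>V. g a) \<le> (\<Sum>a\<in>V. g a * y a)\<^sup>2"
proof -
  define W s where "W = (\<Sum>a\<in>V. g a)" and "s = (\<Sum>a\<in>V. g a * y a)"
  have "0 \<le> W" unfolding W_def by (intro sum_nonneg g_nonneg)
  \<comment> \<open>The mean-zero part of \<open>y\<close>, multiplied by \<open>W\<close> to avoid
    a division.\<close>
  define u where "u = (\<lambda>a. W * y a + (- s) * 1)"
  have "mean_zero u"
    unfolding mean_zero_def u_def
    by (simp add: ring_distribs sum_subtractf mult.left_commute[of _ W] mult.commute[of _ s]
        flip: sum_distrib_left W_def s_def)
  then have "inner_g u (B u) \<le> 0" using B_nonpos_on_mean_zero[of z \<epsilon> u] assms by blast
  moreover have "inner_g u (B u) = W\<^sup>2 * inner_g y (B y) - W * s\<^sup>2"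
  proof -
    have 1: "inner_g y (B (\<lambda>_. 1)) = s" unfolding inner_B
      using sum_G_weight[of y] by (simp add: s_def)
    have 2: "inner_g (\<lambda>_. 1) (B y) = s" unfolding inner_B
      using sum_G_weight'[of y] by (simp add: s_def)
    have 3: "inner_g (\<lambda>_. 1) (B (\<lambda>_. 1)) = W" unfolding inner_B
      by (simp add: W_def g_def)
    show ?thesis
      unfolding u_def B_linear inner_add_right inner_commute[of "\<lambda>a. W * y a + (- s) * 1"]
      using 1 2 3 by (simp add: inner_commute[of "B _"] power2_eq_square algebra_simps)
  qed
  ultimately have *: "W * (W * inner_g y (B y) - s\<^sup>2) \<le> 0"
    by (simp add: power2_eq_square algebra_simps)
  show ?thesis
  proof (cases "W = 0")
    case True
    then show ?thesis by (simp add: W_def)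
  next
    case False
    then have "W * inner_g y (B y) - s\<^sup>2 \<le> 0"
      using * \<open>0 \<le> W\<close> by (simp add: mult_le_0_iff)
    then show ?thesis by (simp add: W_def s_def mult.commute)
  qed
qed

end

section \<open>Symmetric tensors\<close>

text \<open>A symmetric tensor on \<open>V\<close> is a function \<open>F\<close> of multisets;
  \<open>mass F V m U\<close> is its sum over all words of length \<open>m\<close> appended to \<open>U\<close>.\<close>

primrec mass :: "('b multiset \<Rightarrow> real) \<Rightarrow> 'b set \<Rightarrow> nat \<Rightarrow> 'b multiset \<Rightarrow> real" where
  "mass F V 0 = F"
| "mass F V (Suc m) = (\<lambda>U. \<Sum>a\<in>V. mass F V m (add_mset a U))"

text \<open>A reverse Cauchy--Schwarz inequality in which one argument is the all-ones vector.\<close>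

definition hyperbolic_on :: "'b set \<Rightarrow> ('b \<Rightarrow> 'b \<Rightarrow> real) \<Rightarrow> bool" where
  "hyperbolic_on V H \<longleftrightarrow> (\<forall>x. (\<Sum>a\<in>V. \<Sum>b\<in>V. H a b * x a * x b) * (\<Sum>a\<in>V. \<Sum>b\<in>V. H a b)
      \<le> (\<Sum>a\<in>V. \<Sum>b\<in>V. H a b * x a)\<^sup>2)"

lemma mass_nonneg:
  assumes "\<And>U. 0 \<le> F U"
  shows "0 \<le> mass F V m U"
  by (induction m arbitrary: U) (auto simp: assms intro: sum_nonneg)

lemma mass_add_mono:
  assumes "\<And>U. F (add_mset b U) \<le> F U"
  shows "mass F V m (add_mset b U) \<le> mass F V m U"
proof (induction m arbitrary: U)
  case (Suc m)
  show ?case using Suc by (auto simp: add_mset_commute[of _ b] intro!: sum_mono)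
qed (simp add: assms)

lemma mass_add_scale:
  assumes "\<And>U. F (add_mset z U) = t * F U"
  shows "mass F V m (add_mset z U) = t * mass F V m U"
  by (induction m arbitrary: U) (auto simp: assms add_mset_commute[of _ z] sum_distrib_left)

lemma mass_eq_0:
  assumes "\<And>U b. F (add_mset b U) \<le> F U" "\<And>U. 0 \<le> F U" "F U = 0"
  shows "mass F V m U = 0"
  using \<open>F U = 0\<close>
proof (induction m arbitrary: U)
  case (Suc m)
  then have "F (add_mset b U) = 0" for b
    using assms(1)[of b U] assms(2)[of "add_mset b U"] by simp
  then show ?case using Suc.IH by simp
qed simp

lemma mass_hyperbolic:
  assumes V: "finite V" "z \<in> V" and t: "0 < t" "t \<le> 1"
    and nonneg: "\<And>U. 0 \<le> F U"
    and scale: "\<And>U. F (add_mset z U) = t * F U"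
    and mono: "\<And>U b. F (add_mset b U) \<le> F U"
    and base: "\<And>U. hyperbolic_on V (\<lambda>a b. F (add_mset a (add_mset b U)))"
  shows "hyperbolic_on V (\<lambda>a b. mass F V m (add_mset a (add_mset b U)))"
proof (induction m arbitrary: U)
  case 0
  then show ?case using base by simp
next
  case (Suc m)
  define H where "H a b = mass F V (Suc m) (add_mset a (add_mset b U))" for a b
  interpret reversible_kernel V H
    by standard (auto simp: V H_def add_mset_commute intro!: mass_nonneg nonneg sum_nonneg)
  define Q where "Q a x = (\<Sum>b\<in>V. \<Sum>c\<in>V. mass F V m (add_mset b (add_mset c (add_mset a U))) * x b * x c)"
    for a x
  have row: "H a b = (\<Sum>c\<in>V. mass F V m (add_mset b (add_mset c (add_mset a U))))" for a b
    unfolding H_def by (simp add: add_mset_commute)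
  \<comment> \<open>The induction hypothesis at \<open>U + a\<close>: the row sums of its matrix are
    the entries \<open>H a b\<close>, with total \<open>g a\<close>.\<close>
  have Q_le: "Q a x * g a \<le> (\<Sum>b\<in>V. H a b * x b)\<^sup>2" for a x
  proof -
    have "Q a x * g a \<le> (\<Sum>b\<in>V. \<Sum>c\<in>V. mass F V m (add_mset b (add_mset c (add_mset a U))) * x b)\<^sup>2"
      using Suc[of "add_mset a U"] unfolding hyperbolic_on_def Q_def g_def row by blast
    then show ?thesis by (simp add: row sum_distrib_right)
  qed
  have Q_sum: "inner_g x (B x) = (\<Sum>a\<in>V. Q a x)" for x
  proof -
    have "inner_g x (B x) = (\<Sum>b\<in>V. \<Sum>c\<in>V. \<Sum>a\<in>V. mass F V m (add_mset b (add_mset c (add_mset a U))) * x b * x c)"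
      unfolding inner_B H_def by (simp add: sum_distrib_right add_mset_commute)
    also have "\<dots> = (\<Sum>b\<in>V. \<Sum>a\<in>V. \<Sum>c\<in>V. mass F V m (add_mset b (add_mset c (add_mset a U))) * x b * x c)"
      by (intro sum.cong refl sum.swap)
    also have "\<dots> = (\<Sum>a\<in>V. Q a x)" unfolding Q_def by (rule sum.swap)
    finally show ?thesis .
  qed
  \<comment> \<open>An extra letter never increases the mass, so each entry of row \<open>a\<close>
    is at most the mass at \<open>U + a\<close>; the entry at \<open>z\<close> is exactly
    \<open>t\<close> times that mass. Hence the choice \<epsilon> = \<open>t / card V\<close>
    below.\<close>
  have g_le: "g a \<le> card V * mass F V (Suc m) (add_mset a U)" for a
    unfolding g_def H_def add_mset_commute[of a]
    by (rule sum_bounded_above, rule mass_add_mono, rule mono)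
  have square: "inner_g x (B x) \<le> inner_g (B x) (B x)" for x
    unfolding Q_sum unfolding inner_g_def
  proof (rule sum_mono)
    fix a assume a: "a \<in> V"
    \<comment> \<open>This is \<open>Q_le\<close> divided by \<open>g a\<close>; if
      \<open>g a = 0\<close>, nonnegativity makes all entries behind \<open>Q a x\<close>
      vanish.\<close>
    show "Q a x \<le> g a * B x a * B x a"
    proof (cases "g a = 0")
      case True
      have "mass F V m (add_mset b (add_mset c (add_mset a U))) = 0" if "b \<in> V" "c \<in> V" for b c
      proof -
        have *: "H a b = 0" using True sum_nonneg_eq_0_iff[OF V(1), of "H a"] G_nonneg a that
          unfolding g_def by auto
        show ?thesis
          using * sum_nonneg_eq_0_iff[OF V(1), of "\<lambda>c. mass F V m (add_mset b (add_mset c (add_mset a U)))"]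
            mass_nonneg[of F, OF nonneg] that unfolding row by auto
      qed
      then show ?thesis using True by (simp add: Q_def)
    next
      case False
      then have "0 < g a" using g_nonneg[OF a] by simp
      moreover have "Q a x * g a \<le> (g a * B x a)\<^sup>2"
        using Q_le by (simp add: g_times_B a)
      ultimately show ?thesis by (simp add: power2_eq_square mult_ac)
    qed
  qed
  define \<epsilon> where "\<epsilon> = t / card V"
  have c: "1 \<le> real (card V)" using V by (simp add: Suc_le_eq card_gt_0_iff) blast
  have "hyperbolic_on V H" unfolding hyperbolic_on_def
  proof
    fix x
    have "inner_g x (B x) * (\<Sum>a\<in>V. g a) \<le> (\<Sum>a\<in>V. g a * x a)\<^sup>2"
    proof (rule reverse_cauchy_schwarz[OF V(2)])
      show "0 < \<epsilon>" "\<epsilon> \<le> 1" using t c by (auto simp: \<epsilon>_def divide_simps)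
      fix a assume "a \<in> V"
      have "H a z = t * mass F V (Suc m) (add_mset a U)"
        unfolding H_def add_mset_commute[of a] by (rule mass_add_scale[of F z t, OF scale])
      then show "\<epsilon> * g a \<le> H a z"
        using mult_left_mono[OF g_le[of a], of "t / card V"] t c
        by (simp add: \<epsilon>_def)
    qed (rule square)
    then show "(\<Sum>a\<in>V. \<Sum>b\<in>V. H a b * x a * x b) * (\<Sum>a\<in>V. \<Sum>b\<in>V. H a b)
        \<le> (\<Sum>a\<in>V. \<Sum>b\<in>V. H a b * x a)\<^sup>2"
      unfolding inner_B sum_G_weight unfolding g_def by simp
  qed
  then show ?case unfolding H_def[abs_def] .
qed

text \<open>At the indicator of \<open>z\<close> every letter \<open>z\<close> contributes a factor
  \<open>t\<close>, so the three sums in \<open>hyperbolic_on\<close> become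
  \<open>t\<^sup>2\<close> times the mass for \<open>m\<close>, the mass for \<open>m + 2\<close>,
  and \<open>t\<close> times the mass for \<open>m + 1\<close>; then \<open>t\<^sup>2\<close>
  cancels.\<close>

lemma mass_log_concave:
  assumes V: "finite V" "z \<in> V" and t: "0 < t" "t \<le> 1"
    and nonneg: "\<And>U. 0 \<le> F U"
    and scale: "\<And>U. F (add_mset z U) = t * F U"
    and mono: "\<And>U b. F (add_mset b U) \<le> F U"
    and base: "\<And>U. hyperbolic_on V (\<lambda>a b. F (add_mset a (add_mset b U)))"
  shows "mass F V m U * mass F V (Suc (Suc m)) U \<le> (mass F V (Suc m) U)\<^sup>2"
proof -
  define x where "x a = (if a = z then 1 else 0 :: real)" for a
  have x_sum: "(\<Sum>a\<in>V. f a * x a) = f z" for f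
    using V by (simp add: x_def if_distrib[of "(*) _"] sum.delta cong: if_cong)
  have "hyperbolic_on V (\<lambda>a b. mass F V m (add_mset a (add_mset b U)))"
    by (rule mass_hyperbolic[OF assms])
  then have "(\<Sum>a\<in>V. \<Sum>b\<in>V. mass F V m (add_mset a (add_mset b U)) * x a * x b)
      * (\<Sum>a\<in>V. \<Sum>b\<in>V. mass F V m (add_mset a (add_mset b U)))
      \<le> (\<Sum>a\<in>V. \<Sum>b\<in>V. mass F V m (add_mset a (add_mset b U)) * x a)\<^sup>2"
    unfolding hyperbolic_on_def by blast
  moreover have "(\<Sum>a\<in>V. \<Sum>b\<in>V. mass F V m (add_mset a (add_mset b U)) * x a * x b)
      = t * (t * mass F V m U)"
    by (simp only: x_sum) (simp add: mass_add_scale[of F z t, OF scale])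
  moreover have "(\<Sum>a\<in>V. \<Sum>b\<in>V. mass F V m (add_mset a (add_mset b U))) = mass F V (Suc (Suc m)) U"
    by (simp add: add_mset_commute)
  moreover have "(\<Sum>a\<in>V. \<Sum>b\<in>V. mass F V m (add_mset a (add_mset b U)) * x a) = t * mass F V (Suc m) U"
    unfolding sum_distrib_right[symmetric] x_sum
    by (simp add: mass_add_scale[of F z t, OF scale] sum_distrib_left)
  ultimately have "t\<^sup>2 * (mass F V m U * mass F V (Suc (Suc m)) U) \<le> t\<^sup>2 * (mass F V (Suc m) U)\<^sup>2"
    by (simp only: power_mult_distrib) (simp add: power2_eq_square mult_ac)
  then show ?thesis using t by simp
qed

section \<open>Criteria for hyperbolicity\<close>

text \<open>On the elements related to themselves \<open>r\<close> is an equivalence, so the form is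
  the sum of the squared class sums of \<open>x\<close>; \<open>s b * (s b / c b)\<close> spreads
  each square evenly over its class.\<close>

lemma partial_equivalence_psd:
  fixes x :: "'b \<Rightarrow> real"
  assumes V: "finite V" and r: "symp r" "transp r"
  shows "0 \<le> (\<Sum>a\<in>V. \<Sum>b\<in>V. of_bool (r a b) * x a * x b)"
proof -
  define s c where "s a = (\<Sum>b\<in>V. of_bool (r a b) * x b)" and "c a = (\<Sum>b\<in>V. of_bool (r a b) :: real)" for a
  have eq: "s a = s b" "c a = c b" if "r a b" for a b
  proof -
    have "r a d = r b d" for d using that r by (meson sympD transpD)
    then show "s a = s b" "c a = c b" by (auto simp: s_def c_def)
  qed
  have "(\<Sum>a\<in>V. \<Sum>b\<in>V. of_bool (r a b) * x a * x b) = (\<Sum>a\<in>V. x a * s a)"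
    by (simp add: s_def sum_distrib_left mult_ac)
  also have "\<dots> = (\<Sum>a\<in>V. x a * s a / c a * c a)"
  proof (rule sum.cong[OF refl])
    fix a assume "a \<in> V"
    show "x a * s a = x a * s a / c a * c a"
    proof (cases "c a = 0")
      case True
      then have "\<forall>b\<in>V. \<not> r a b"
        unfolding c_def using V by (subst (asm) sum_nonneg_eq_0_iff) auto
      then show ?thesis by (simp add: s_def)
    qed simp
  qed
  also have "\<dots> = (\<Sum>a\<in>V. \<Sum>b\<in>V. of_bool (r a b) * (x a * s a / c a))"
    unfolding sum_distrib_right[symmetric] c_def[symmetric] by (simp only: mult.commute)
  also have "\<dots> = (\<Sum>b\<in>V. \<Sum>a\<in>V. of_bool (r a b) * (x a * s a / c a))" by (rule sum.swap)
  also have "\<dots> = (\<Sum>b\<in>V. \<Sum>a\<in>V. of_bool (r b a) * x a * (s b / c b))"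
    using eq sympD[OF r(1)] by (intro sum.cong refl) (auto simp: of_bool_def)
  also have "\<dots> = (\<Sum>b\<in>V. s b * (s b / c b))"
    unfolding s_def by (simp only: sum_distrib_right)
  also have "\<dots> \<ge> 0"
    by (intro sum_nonneg) (simp add: c_def sum_nonneg)
  finally show ?thesis .
qed

text \<open>A rank-one form minus a positive semidefinite form is negative semidefinite on the kernel
  of the linear form, which contains \<open>\<ell>(1) x - \<ell>(x) 1\<close>.\<close>

lemma hyperbolic_on_rank_one_minus_psd:
  assumes p_sym: "\<And>a b. p a b = p b a"
    and psd: "\<And>x. 0 \<le> (\<Sum>a\<in>V. \<Sum>b\<in>V. p a b * x a * x b)"
    and H: "\<And>a b. a \<in> V \<Longrightarrow> b \<in> V \<Longrightarrow> H a b = w a * w b - p a b"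
    and pos: "0 < (\<Sum>a\<in>V. \<Sum>b\<in>V. H a b)"
  shows "hyperbolic_on V H"
  unfolding hyperbolic_on_def
proof
  fix x
  define P where "P x y = (\<Sum>a\<in>V. \<Sum>b\<in>V. p a b * x a * y b)" for x y
  define l where "l x = (\<Sum>a\<in>V. w a * x a)" for x
  have P_lin: "P (\<lambda>a. c * x a + d) (\<lambda>a. c * x a + d)
      = c\<^sup>2 * P x x + 2 * c * d * P x (\<lambda>_. 1) + d\<^sup>2 * P (\<lambda>_. 1) (\<lambda>_. 1)" for c d
  proof -
    have "P (\<lambda>_. 1) x = P x (\<lambda>_. 1)"
      unfolding P_def by (subst sum.swap) (simp add: p_sym)
    moreover have "P (\<lambda>a. c * x a + d) (\<lambda>a. c * x a + d)
      = c\<^sup>2 * P x x + c * d * P x (\<lambda>_. 1) + c * d * P (\<lambda>_. 1) x + d\<^sup>2 * P (\<lambda>_. 1) (\<lambda>_. 1)"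
      unfolding P_def
      by (simp add: sum_distrib_left sum.distrib[symmetric] power2_eq_square algebra_simps)
    ultimately show ?thesis by simp
  qed
  have form: "(\<Sum>a\<in>V. \<Sum>b\<in>V. H a b * x a * y b) = l x * l y - P x y" for x y
  proof -
    have "(\<Sum>a\<in>V. \<Sum>b\<in>V. H a b * x a * y b)
        = (\<Sum>a\<in>V. \<Sum>b\<in>V. (w a * x a) * (w b * y b) - p a b * x a * y b)"
      by (intro sum.cong refl) (auto simp: H algebra_simps)
    then show ?thesis by (simp add: sum_subtractf l_def P_def sum_product)
  qed
  define L M where "L = l (\<lambda>_. 1)" and "M = l x"
  define q q1 q2 where "q = M * M - P x x" and "q1 = M * L - P x (\<lambda>_. 1)"
    and "q2 = L * L - P (\<lambda>_. 1) (\<lambda>_. 1)"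
  have q2: "0 < q2" using pos form[of "\<lambda>_. 1" "\<lambda>_. 1"] by (simp add: q2_def L_def)
  moreover have "0 \<le> P (\<lambda>_. 1) (\<lambda>_. 1)" unfolding P_def by (rule psd)
  ultimately have L: "0 < L\<^sup>2" by (simp add: q2_def power2_eq_square)
  have "0 \<le> P (\<lambda>a. L * x a + (- M)) (\<lambda>a. L * x a + (- M))" unfolding P_def by (rule psd)
  then have "L\<^sup>2 * q - 2 * L * M * q1 + M\<^sup>2 * q2 \<le> 0"
    unfolding P_lin q_def q1_def q2_def by (simp add: power2_eq_square algebra_simps)
  \<comment> \<open>Multiplying by \<open>q2\<close> lets the square of
    \<open>M * q2 - L * q1\<close> be split off.\<close>
  then have "q2 * (L\<^sup>2 * q - 2 * L * M * q1 + M\<^sup>2 * q2) \<le> 0"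
    using q2 by (simp add: mult_le_0_iff)
  then have "(M * q2 - L * q1)\<^sup>2 + L\<^sup>2 * (q * q2 - q1\<^sup>2) \<le> 0"
    by (simp add: power2_eq_square algebra_simps)
  then have "L\<^sup>2 * (q * q2 - q1\<^sup>2) \<le> 0"
    using zero_le_power2[of "M * q2 - L * q1"] by linarith
  then have "q * q2 \<le> q1\<^sup>2" using L by (simp add: mult_le_0_iff)
  then show "(\<Sum>a\<in>V. \<Sum>b\<in>V. H a b * x a * x b) * (\<Sum>a\<in>V. \<Sum>b\<in>V. H a b)
      \<le> (\<Sum>a\<in>V. \<Sum>b\<in>V. H a b * x a)\<^sup>2"
    using form[of x x] form[of x "\<lambda>_. 1"] form[of "\<lambda>_. 1" "\<lambda>_. 1"]
    by (simp add: q_def q1_def q2_def L_def M_def)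
qed


section \<open>Matroids\<close>

definition support :: "'a option multiset \<Rightarrow> 'a set" where
  "support U = {i. Some i \<in># U}"

definition indep_word :: "'a set set \<Rightarrow> 'a option multiset \<Rightarrow> bool" where
  "indep_word \<I> U \<longleftrightarrow> (\<forall>i. count U (Some i) \<le> 1) \<and> support U \<in> \<I>"

text \<open>The letter \<^term>\<open>None\<close> plays the role of a homogenizing variable.\<close>

definition word_weight :: "'a set set \<Rightarrow> real \<Rightarrow> 'a option multiset \<Rightarrow> real" where
  "word_weight \<I> t U = t ^ count U None * of_bool (indep_word \<I> U)"

lemma support_add [simp]:
  "support (add_mset None U) = support U"
  "support (add_mset (Some i) U) = insert i (support U)"
  by (auto simp: support_def)

lemma indep_word_add_None [simp]: "indep_word \<I> (add_mset None U) = indep_word \<I> U"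
  by (simp add: indep_word_def)

lemma word_weight_add_None: "word_weight \<I> t (add_mset None U) = t * word_weight \<I> t U"
  by (simp add: word_weight_def)

lemma word_weight_nonneg: "0 \<le> t \<Longrightarrow> 0 \<le> word_weight \<I> t U"
  by (simp add: word_weight_def)

context matroid
begin

lemma indep_word_add_Some:
  "indep_word \<I> (add_mset (Some i) U)
    \<longleftrightarrow> indep_word \<I> U \<and> i \<notin> support U \<and> insert i (support U) \<in> \<I>"
proof -
  have "count (add_mset (Some i) U) (Some j) \<le> 1
      \<longleftrightarrow> count U (Some j) \<le> 1 \<and> (j = i \<longrightarrow> i \<notin> support U)" for j
    by (cases "j = i") (auto simp: support_def not_in_iff)
  moreover have "insert i (support U) \<in> \<I> \<Longrightarrow> support U \<in> \<I>"
    by (erule indep_hereditary) auto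
  ultimately show ?thesis
    unfolding indep_word_def support_add by blast
qed

lemma word_weight_add_le:
  assumes "0 \<le> t" "t \<le> 1"
  shows "word_weight \<I> t (add_mset b U) \<le> word_weight \<I> t U"
proof (cases b)
  case None
  then show ?thesis
    using assms word_weight_nonneg[of t \<I> U] by (simp add: word_weight_add_None mult_left_le_one_le)
next
  case (Some i)
  then show ?thesis using assms by (simp add: word_weight_def indep_word_add_Some)
qed

lemma finite_indep: "X \<in> \<I> \<Longrightarrow> finite X"
  using finite_ground indep_subset_ground finite_subset by blast

text \<open>For independent \<open>U\<close>, \<open>r\<close> is parallelism of non-loops in the
  contraction by \<open>support U\<close>, each being parallel to itself since letters may not
  repeat. Two letters that extend \<open>U\<close> separately fail to do so jointly exactly when
  they are parallel, which gives the rank-one form \<open>w a * w b\<close> minus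
  \<open>r\<close>.\<close>

lemma word_weight_hyperbolic:
  assumes t: "0 < t" "t \<le> 1"
  shows "hyperbolic_on (insert None (Some ` E))
    (\<lambda>a b. word_weight \<I> t (add_mset a (add_mset b U)))" (is "hyperbolic_on ?V ?H")
proof (cases "indep_word \<I> U")
  case False
  then have "?H a b = 0" for a b
    by (cases a; cases b) (auto simp: word_weight_def indep_word_add_Some)
  then show ?thesis by (simp add: hyperbolic_on_def)
next
  case True
  define c where "c = t ^ count U None"
  have c: "0 < c" using t by (simp add: c_def)
  define w where "w a = (case a of None \<Rightarrow> t | Some i \<Rightarrow> of_bool (indep_word \<I> (add_mset a U)))" for a
  define r where "r a b \<longleftrightarrow> a \<noteq> None \<and> b \<noteq> None \<and> indep_word \<I> (add_mset a U) \<and>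
      indep_word \<I> (add_mset b U) \<and> \<not> indep_word \<I> (add_mset a (add_mset b U))" for a b
  have finite_V: "finite ?V" by (simp add: finite_ground)
  have sym: "symp r" by (rule sympI) (auto simp: r_def add_mset_commute)
  have trans: "transp r"
  proof (rule transpI)
    fix a b d assume "r a b" "r b d"
    then obtain i j k where ijk: "a = Some i" "b = Some j" "d = Some k"
      by (auto simp: r_def)
    let ?S = "support U"
    have i: "i \<notin> ?S" and j: "j \<notin> ?S" "insert j ?S \<in> \<I>" and k: "k \<notin> ?S"
      and dep: "\<And>y. y = i \<or> y = k \<Longrightarrow> y \<notin> insert j ?S \<Longrightarrow> insert y (insert j ?S) \<notin> \<I>"
      using \<open>r a b\<close> \<open>r b d\<close>
      by (auto simp: r_def ijk indep_word_add_Some insert_commute)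
    \<comment> \<open>If \<open>i\<close> and \<open>k\<close> were independent over
      \<open>?S\<close>, augmentation would add one of them to \<open>insert j ?S\<close>, but both
      are parallel to \<open>j\<close>.\<close>
    have "\<not> indep_word \<I> (add_mset a (add_mset d U))"
    proof
      assume "indep_word \<I> (add_mset a (add_mset d U))"
      then have ik: "i \<noteq> k" "insert i (insert k ?S) \<in> \<I>"
        by (auto simp: ijk indep_word_add_Some)
      have "finite ?S" using finite_indep[OF j(2)] by simp
      then have "card (insert j ?S) < card (insert i (insert k ?S))"
        using i j k ik by simp
      then obtain y where "y \<in> insert i (insert k ?S) - insert j ?S" "insert y (insert j ?S) \<in> \<I>"
        using indep_augment j(2) ik(2) by blast
      then show False using dep by auto
    qed
    then show "r a d" using \<open>r a b\<close> \<open>r b d\<close> by (auto simp: r_def)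
  qed
  show ?thesis
  proof (rule hyperbolic_on_rank_one_minus_psd[where w = "\<lambda>a. sqrt c * w a"
        and p = "\<lambda>a b. c * of_bool (r a b)"])
    show "c * of_bool (r a b) = c * of_bool (r b a)" for a b
      using sympD[OF sym] by (auto simp: of_bool_def)
    show "0 \<le> (\<Sum>a\<in>?V. \<Sum>b\<in>?V. c * of_bool (r a b) * x a * x b)" for x
      using mult_nonneg_nonneg[OF less_imp_le[OF c] partial_equivalence_psd[OF finite_V sym trans, of x]]
      unfolding sum_distrib_left mult.assoc .
    have "insert i S \<in> \<I>" if "insert i (insert j S) \<in> \<I>" for i j S
      using indep_hereditary[OF that, of "insert i S"] by auto
    then have "?H a b = c * (w a * w b - of_bool (r a b))" for a b
      using True
      by (cases a; cases b)
        (auto simp: word_weight_def c_def w_def r_def indep_word_add_Some)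
    then show "?H a b = sqrt c * w a * (sqrt c * w b) - c * of_bool (r a b)" for a b
      using c by (simp add: algebra_simps)
    have nonneg: "0 \<le> ?H a b" for a b using t by (simp add: word_weight_nonneg)
    have "0 < ?H None None" using True t by (simp add: word_weight_def)
    also have "\<dots> \<le> (\<Sum>b\<in>?V. ?H None b)"
      by (rule member_le_sum) (auto simp: finite_ground nonneg)
    also have "\<dots> \<le> (\<Sum>a\<in>?V. \<Sum>b\<in>?V. ?H a b)"
      by (rule member_le_sum) (auto simp: finite_ground simp del: sum.insert intro!: sum_nonneg nonneg)
    finally show "0 < (\<Sum>a\<in>?V. \<Sum>b\<in>?V. ?H a b)" .
  qed
qed

text \<open>At \<open>t = 0\<close> only words without \<open>None\<close> have weight, by
  \<open>0 ^ 0 = 1\<close>. Each independent \<open>Y\<close> counted on the right arises from the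
  \<open>m!\<close> orderings of \<open>Y - support U\<close>.\<close>

lemma mass_word_weight_0:
  assumes "indep_word \<I> U" "None \<notin># U"
  shows "mass (word_weight \<I> 0) (insert None (Some ` E)) m U
    = fact m * card {Y \<in> \<I>. support U \<subseteq> Y \<and> card Y = card (support U) + m}"
  using assms
proof (induction m arbitrary: U)
  case 0
  have "{Y \<in> \<I>. support U \<subseteq> Y \<and> card Y = card (support U) + 0} = {support U}"
    using 0 by (auto simp: indep_word_def dest: card_subset_eq[OF finite_indep])
  then show ?case using 0 by (simp add: word_weight_def not_in_iff)
next
  case (Suc m)
  let ?S = "support U" and ?V = "insert None (Some ` E)"
  let ?Y = "{Y \<in> \<I>. ?S \<subseteq> Y \<and> card Y = card ?S + Suc m}"
  have S: "finite ?S" "?S \<subseteq> E"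
    using Suc.prems finite_indep indep_subset_ground by (auto simp: indep_word_def)
  have zero: "mass (word_weight \<I> 0) ?V m (add_mset (Some i) U) = 0"
    if "\<not> indep_word \<I> (add_mset (Some i) U)" for i
    using that by (intro mass_eq_0 word_weight_add_le word_weight_nonneg) (auto simp: word_weight_def)
  have step: "mass (word_weight \<I> 0) ?V m (add_mset (Some i) U) = fact m * card {Y \<in> ?Y. i \<in> Y}"
    if "i \<in> E - ?S" for i
  proof (cases "indep_word \<I> (add_mset (Some i) U)")
    case True
    have "{Y \<in> \<I>. insert i ?S \<subseteq> Y \<and> card Y = card (insert i ?S) + m} = {Y \<in> ?Y. i \<in> Y}"
      using that S by auto
    then show ?thesis using Suc.IH[OF True] Suc.prems by simp
  next
    case False
    then have "insert i ?S \<notin> \<I>" using that Suc.prems by (simp add: indep_word_add_Some)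
    then have empty: "{Y \<in> ?Y. i \<in> Y} = {}" using indep_hereditary[of _ "insert i ?S"] by auto
    show ?thesis unfolding empty using zero[OF False] by simp
  qed
  \<comment> \<open>Double counting of pairs \<open>(i, Y)\<close>: any of the \<open>Suc m\<close>
    new elements of \<open>Y\<close> can be the first letter.\<close>
  have count: "(\<Sum>i\<in>E - ?S. card {Y \<in> ?Y. i \<in> Y}) = (\<Sum>Y\<in>?Y. Suc m)"
  proof (rule sum_multicount_gen[where R = "(\<in>)" and t = ?Y])
    show "finite ?Y"
      by (rule finite_subset[of _ "Pow E"]) (auto simp: finite_ground dest: indep_subset_ground)
    show "\<forall>Y\<in>?Y. card {i \<in> E - ?S. i \<in> Y} = Suc m"
    proof
      fix Y assume Y: "Y \<in> ?Y"
      then have "{i \<in> E - ?S. i \<in> Y} = Y - ?S" using indep_subset_ground by auto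
      then show "card {i \<in> E - ?S. i \<in> Y} = Suc m"
        using Y S by (simp add: card_Diff_subset)
    qed
  qed (simp add: finite_ground)
  have "mass (word_weight \<I> 0) ?V (Suc m) U
      = (\<Sum>i\<in>E. mass (word_weight \<I> 0) ?V m (add_mset (Some i) U))"
    by (simp add: finite_ground mass_add_scale[of _ None 0] word_weight_add_None sum.reindex)
  also have "\<dots> = (\<Sum>i\<in>E - ?S. mass (word_weight \<I> 0) ?V m (add_mset (Some i) U))"
    using S by (intro sum.mono_neutral_right finite_ground) (auto simp: zero indep_word_add_Some)
  also have "\<dots> = fact m * real (\<Sum>i\<in>E - ?S. card {Y \<in> ?Y. i \<in> Y})"
    by (simp add: step sum_distrib_left)
  also have "\<dots> = fact (Suc m) * card ?Y"
    unfolding count by (simp add: algebra_simps)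
  finally show ?case .
qed

section \<open>Passage to the limit and removal of the factorials\<close>

lemma isCont_mass_word_weight: "isCont (\<lambda>t. mass (word_weight \<I> t) V m U) s"
  by (induction m arbitrary: U) (auto simp: word_weight_def intro!: continuous_intros)

lemma fact_num_indep_log_concave:
  "(fact m * real (num_indep \<I> m)) * (fact (m + 2) * real (num_indep \<I> (m + 2)))
    \<le> (fact (m + 1) * real (num_indep \<I> (m + 1)))\<^sup>2"
proof -
  define f where "f t m = mass (word_weight \<I> t) (insert None (Some ` E)) m {#}" for t m
  have f0: "f 0 m = fact m * real (num_indep \<I> m)" for m
    unfolding f_def using mass_word_weight_0[of "{#}" m] indep_empty
    by (simp add: indep_word_def support_def num_indep_def)
  \<comment> \<open>The limit is taken from the right because the inequality for \<open>f t\<close>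
    is available only for \<open>t > 0\<close>.\<close>
  have lim: "((\<lambda>t. f t m) \<longlongrightarrow> f 0 m) (at_right 0)" for m
    using isCont_mass_word_weight[where V = "insert None (Some ` E)" and m = m and U = "{#}" and s = 0]
    unfolding f_def isCont_def by (rule filterlim_mono) (auto simp: at_le)
  have "f 0 m * f 0 (Suc (Suc m)) \<le> (f 0 (Suc m))\<^sup>2"
  proof (rule tendsto_le)
    show "((\<lambda>t. f t m * f t (Suc (Suc m))) \<longlongrightarrow> f 0 m * f 0 (Suc (Suc m))) (at_right 0)"
      "((\<lambda>t. (f t (Suc m))\<^sup>2) \<longlongrightarrow> (f 0 (Suc m))\<^sup>2) (at_right 0)"
      by (intro tendsto_intros lim)+
    have "f t m * f t (Suc (Suc m)) \<le> (f t (Suc m))\<^sup>2" if "0 < t" "t < 1" for t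
      unfolding f_def
    proof (rule mass_log_concave[where z = None and t = t])
      show "word_weight \<I> t (add_mset b U) \<le> word_weight \<I> t U" for b U
        using that by (intro word_weight_add_le) auto
      show "hyperbolic_on (insert None (Some ` E))
          (\<lambda>a b. word_weight \<I> t (add_mset a (add_mset b U)))" for U
        using that by (intro word_weight_hyperbolic) auto
    qed (use that in \<open>auto simp: finite_ground word_weight_nonneg word_weight_add_None\<close>)
    then show "\<forall>\<^sub>F t in at_right 0. f t m * f t (Suc (Suc m)) \<le> (f t (Suc m))\<^sup>2"
      by (intro eventually_at_rightI[of 0 1]) auto
  qed simp
  then show ?thesis unfolding f0 by (simp only: Suc_eq_plus1 add_2_eq_Suc')
qed

text \<open>Cancelling the common factor of the factorials leaves
  \<open>(m + 2) * (p * s) \<le> (m + 1) * q\<^sup>2\<close>, and lowering \<open>m + 2\<close> to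
  \<open>m + 1\<close> only weakens this.\<close>

lemma num_indep_log_concave:
  "num_indep \<I> m * num_indep \<I> (m + 2) \<le> (num_indep \<I> (m + 1))\<^sup>2"
proof -
  define p q s where "p = real (num_indep \<I> m)" and "q = real (num_indep \<I> (m + 1))"
    and "s = real (num_indep \<I> (m + 2))"
  define f where "f = (fact m :: real)"
  have fact_eqs: "fact (m + 1) = real (m + 1) * f" "fact (m + 2) = real (m + 2) * (real (m + 1) * f)"
    by (simp_all add: f_def)
  have "(f\<^sup>2 * real (m + 1)) * (real (m + 2) * (p * s)) \<le> (f\<^sup>2 * real (m + 1)) * (real (m + 1) * q\<^sup>2)"
    using fact_num_indep_log_concave[of m]
    unfolding fact_eqs p_def[symmetric] q_def[symmetric] s_def[symmetric] f_def[symmetric]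
    by (simp only: power2_eq_square mult_ac)
  moreover have "0 < f\<^sup>2 * real (m + 1)" by (simp add: f_def)
  ultimately have "real (m + 2) * (p * s) \<le> real (m + 1) * q\<^sup>2" by (rule mult_left_le_imp_le)
  moreover have "0 \<le> p * s" by (simp add: p_def s_def)
  ultimately have "(m + 1) * (p * s) \<le> (m + 1) * q\<^sup>2" by (simp add: algebra_simps)
  then have "p * s \<le> q\<^sup>2" by simp
  then show ?thesis unfolding p_def q_def s_def by (simp flip: of_nat_mult of_nat_power)
qed

end

theorem theorem3p3p17:
  fixes E :: "'a set" and \<I> :: "'a set set" and n k :: nat
  assumes "matroid E \<I>"
    and "matroid_rank E \<I> = n"
    and "2 \<le> k" and "k \<le> n - 1"
  shows "(num_indep \<I> k)\<^sup>2 \<ge> num_indep \<I> (k - 1) * num_indep \<I> (k + 1)"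
  \<comment> \<open>As \<open>2 \<le> k\<close>, the truncated difference \<open>k - 1\<close> is
    exact, so \<open>m + 1 = k\<close> and \<open>m + 2 = k + 1\<close>.\<close>
  using matroid.num_indep_log_concave[OF assms(1), of "k - 1"] assms(3) by simp

end
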